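(* Let $(\mathfrak A,\mathfrak B,\mathfrak C)$ be a Sturmian lattice which is either strictly $3$-color, or $2$-color with slope $0$ or $1$. Then, for some real $\kappa$, the coordinates in each of the three directions have the form $f(n)=n\kappa+\varepsilon(n)$ with some $\varepsilon:\mathbb Z\to\{-\frac12,\frac12\}$. More precisely, up to isometry one of the following holds: (i) $a(i)=i\kappa+\varepsilon(i)$ with an arbitrary $\varepsilon:\mathbb Z\to\{-\frac12,\frac12\}$, $b(j)=j\kappa-\frac12$, $c(k)=k\kappa+\frac12$; (ii) either $a(i)=i\kappa-\frac12$ for $i>0$, $a(i)=i\kappa+\frac12$ for $i\le0$, $b(j)=j\kappa-\frac12$ for $j\ge0$, $b(j)=j\kappa+\frac12$ for $j<0$, $c(k)=k\kappa-\frac12$ for $k\ge0$, $c(k)=k\kappa+\frac12$ for $k<0$; or the same with all signs of $\pm\frac12$ reversed, i.e. $a(i)=i\kappa+\frac12$ for $i>0$, $i\kappa-\frac12$ for $i\le0$, $b(j)=j\kappa+\frac12$ for $j\ge0$, $j\kappa-\frac12$ for $j<0$, $c(k)=k\kappa+\frac12$ for $k\ge0$, $k\kappa-\frac12$ for $k<0$.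
   Context: A Sturmian lattice is a triple of real sequences $(a(i))_{i\in\mathbb Z},(b(j))_{j\in\mathbb Z},(c(k))_{k\in\mathbb Z}$ with all consecutive differences (widths) $\ge1$, for which there exists $V\subset\mathbb Z^3$ with $(0,0,0)\in V$, such that for each pair among $(j,k)$, $(k,i)$, $(i,j)$ there is exactly one value of the remaining index with $(i,j,k)\in V$, and $|a(i)+b(j)+c(k)|=1/2$ for all $(i,j,k)\in V$. It is $n$-color if the set of all widths in all three directions has at most $n$ elements, strictly $n$-color if moreover not $(n-1)$-color. For a $2$-color lattice with minimal width $\kappa_0$, widths lie in $\{\kappa_0,\kappa_0+1\}$ and the slope is the limiting density $\lim_{N\to\infty}\frac1{2N}\#\{i\in[-N,N):a(i+1)-a(i)=\kappa_0+1\}$. Isometries refer to the planar realization with line families at angles $0,2\pi/3,4\pi/3$ (permuting/reversing directions).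
   Formalization: The first claim, that the coordinates have the form nκ+ε(n), is stated up to a translation of the plane (shifts s,t,u with s+t+u=0); literally it fails, e.g. for a(i)=2i+1/8, b(j)=2j, c(k)=2k+3/8. *)

theory Defs
  imports "HOL-Analysis.Analysis"
begin

text \<open>
  \<open>incidence a b c V\<close>: the index set \<open>V\<close> is a witness for the three coordinate sequences
  \<open>a\<close>, \<open>b\<close>, \<open>c\<close> forming a Sturmian lattice (apart from the lower bound on the widths).
\<close>

definition incidence ::
    "(int \<Rightarrow> real) \<Rightarrow> (int \<Rightarrow> real) \<Rightarrow> (int \<Rightarrow> real) \<Rightarrow> (int \<times> int \<times> int) set \<Rightarrow> bool" where
  "incidence a b c V \<longleftrightarrow>
     (0, 0, 0) \<in> V \<and>
     (\<forall>j k. \<exists>!i. (i, j, k) \<in> V) \<and>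
     (\<forall>k i. \<exists>!j. (i, j, k) \<in> V) \<and>
     (\<forall>i j. \<exists>!k. (i, j, k) \<in> V) \<and>
     (\<forall>i j k. (i, j, k) \<in> V \<longrightarrow> \<bar>a i + b j + c k\<bar> = 1 / 2)"

definition width :: "(int \<Rightarrow> real) \<Rightarrow> int \<Rightarrow> real" where
  "width f n = f (n + 1) - f n"

definition sturmian_lattice ::
    "(int \<Rightarrow> real) \<Rightarrow> (int \<Rightarrow> real) \<Rightarrow> (int \<Rightarrow> real) \<Rightarrow> bool" where
  "sturmian_lattice a b c \<longleftrightarrow>
     (\<forall>n. width a n \<ge> 1 \<and> width b n \<ge> 1 \<and> width c n \<ge> 1) \<and>
     (\<exists>V. incidence a b c V)"

definition widths ::
    "(int \<Rightarrow> real) \<Rightarrow> (int \<Rightarrow> real) \<Rightarrow> (int \<Rightarrow> real) \<Rightarrow> real set" where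
  "widths a b c = range (width a) \<union> range (width b) \<union> range (width c)"

definition n_color ::
    "nat \<Rightarrow> (int \<Rightarrow> real) \<Rightarrow> (int \<Rightarrow> real) \<Rightarrow> (int \<Rightarrow> real) \<Rightarrow> bool" where
  "n_color n a b c \<longleftrightarrow> finite (widths a b c) \<and> card (widths a b c) \<le> n"

definition strictly_n_color ::
    "nat \<Rightarrow> (int \<Rightarrow> real) \<Rightarrow> (int \<Rightarrow> real) \<Rightarrow> (int \<Rightarrow> real) \<Rightarrow> bool" where
  "strictly_n_color n a b c \<longleftrightarrow> n_color n a b c \<and> \<not> n_color (n - 1) a b c"

text \<open>
  The slope is stated as a relation, so that having slope \<open>s\<close> includes the existence of the
  limit.  It is meant for 2-color lattices, where \<open>widths a b c\<close> is finite and \<open>Min\<close> is the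
  minimal width over all three directions; the density is that of the first direction.
\<close>

definition has_slope ::
    "(int \<Rightarrow> real) \<Rightarrow> (int \<Rightarrow> real) \<Rightarrow> (int \<Rightarrow> real) \<Rightarrow> real \<Rightarrow> bool" where
  "has_slope a b c s \<longleftrightarrow>
     (\<lambda>N::nat. real (card {i \<in> {- int N..<int N}. width a i = Min (widths a b c) + 1})
                / (2 * real N)) \<longlonglongrightarrow> s"

text \<open>
  Planar realization in the complex plane.  \<open>line \<theta> x\<close> is the line in direction \<open>cis \<theta>\<close> at signed
  distance \<open>x\<close> from the origin.  The three unit normals \<open>\<i> * cis \<theta>\<close> for the angles
  \<open>0, 2\<pi>/3, 4\<pi>/3\<close> sum to zero, so a translation of the plane shifts the coordinates of the
  three families by real numbers with sum \<open>0\<close>.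
\<close>

definition line :: "real \<Rightarrow> real \<Rightarrow> complex set" where
  "line \<theta> x = {p. inner p (\<i> * cis \<theta>) = x}"

definition line_triples ::
    "(int \<Rightarrow> real) \<Rightarrow> (int \<Rightarrow> real) \<Rightarrow> (int \<Rightarrow> real) \<Rightarrow> (int \<times> int \<times> int) set
      \<Rightarrow> complex set set set" where
  "line_triples a b c V =
     {{line 0 (a i), line (2 * pi / 3) (b j), line (4 * pi / 3) (c k)} | i j k. (i, j, k) \<in> V}"

text \<open>
  An isometry of lattices is an isometry of the plane carrying the lines of one realization to
  those of the other, in such a way that the triples of lines singled out by the index sets
  correspond.  (Every line lies in such a triple.)  It may permute the three families and
  reverse the directions, and since only lines and no indices occur, it may also renumber the
  lines, subject to \<open>(0, 0, 0)\<close> indexing one of the distinguished triples.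
\<close>

definition isometric_lattices ::
    "(int \<Rightarrow> real) \<Rightarrow> (int \<Rightarrow> real) \<Rightarrow> (int \<Rightarrow> real) \<Rightarrow>
     (int \<Rightarrow> real) \<Rightarrow> (int \<Rightarrow> real) \<Rightarrow> (int \<Rightarrow> real) \<Rightarrow> bool" where
  "isometric_lattices a b c a' b' c' \<longleftrightarrow>
     (\<exists>(T :: complex \<Rightarrow> complex) V V'.
        (\<forall>p q. dist (T p) (T q) = dist p q) \<and>
        incidence a b c V \<and> incidence a' b' c' V' \<and>
        (\<lambda>t. (\<lambda>l. T ` l) ` t) ` line_triples a b c V = line_triples a' b' c' V')"

definition half_perturbed :: "real \<Rightarrow> (int \<Rightarrow> real) \<Rightarrow> bool" where
  "half_perturbed \<kappa> f \<longleftrightarrow>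
     (\<exists>\<epsilon> :: int \<Rightarrow> real. (\<forall>n. \<epsilon> n \<in> {- 1 / 2, 1 / 2}) \<and> (\<forall>n. f n = of_int n * \<kappa> + \<epsilon> n))"

end

theory Submission
  imports Defs
begin

text \<open>
  Monotonicity forces the index set to be the plane \<open>i + j + k = 0\<close>, so widths of different
  directions differ by \<open>-1\<close>, \<open>0\<close> or \<open>1\<close>.  If two widths differ by \<open>2\<close>, they lie in one direction
  and all widths of the other two equal the mean, which gives case (i).  Otherwise there are
  only the widths \<open>m\<close> and \<open>m + 1\<close>; this excludes the strictly 3-color case.  Let \<open>\<kappa>\<close> be the
  width of density \<open>1\<close>.  The deviations from \<open>n\<kappa>\<close> are, up to sign, nondecreasing integer steps
  whose increments over windows of equal length differ by at most \<open>1\<close> between two directions.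
  Two steps in one direction would therefore give every window of some fixed length a step in
  another direction, against the density being \<open>0\<close>.  So each direction has at most one step.
  With at most one step in total this is case (i), two steps are impossible, and three steps,
  at positions \<open>p, q, r\<close>, force \<open>p + q + r \<in> {1, 2}\<close>; a point reflection exchanges the two
  values and a translation then gives case (ii).
\<close>

section \<open>The index set of a Sturmian lattice\<close>

lemma width_sum_ge:
  assumes "\<And>n. width f n \<ge> d" and "i \<le> j"
  shows "f j - f i \<ge> of_int (j - i) * d"
  using assms(2)
proof (induction j rule: int_ge_induct)
  case base
  then show ?case by simp
next
  case (step j)
  then show ?case using assms(1)[of j] by (simp add: width_def algebra_simps)
qed

lemma width_const:
  assumes "\<And>n. width f n = d"
  shows "f n = of_int n * d + f 0"
proof (induction n rule: int_induct[where k = 0])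
  case base
  then show ?case by simp
next
  case (step1 n)
  then show ?case using assms[of n] by (simp add: width_def algebra_simps)
next
  case (step2 n)
  then show ?case using assms[of "n - 1"] by (simp add: width_def algebra_simps)
qed

text \<open>\<open>R\<close> is the graph of a strictly decreasing bijection of the integers. Such a
  map cannot skip a value, so it lowers \<open>k\<close> by exactly one whenever \<open>i\<close>
  rises by one.\<close>

lemma decreasing_relation_shift:
  fixes R :: "int \<Rightarrow> int \<Rightarrow> bool"
  assumes total: "\<And>i. \<exists>k. R i k" "\<And>k. \<exists>i. R i k"
    and decr: "\<And>i i' k k'. R i k \<Longrightarrow> R i' k' \<Longrightarrow> i < i' \<Longrightarrow> k' < k"
    and func: "\<And>i k k'. R i k \<Longrightarrow> R i k' \<Longrightarrow> k = k'"
    and "R i k"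
  shows "R (i + n) (k - n)"
proof -
  have decr': "i < i'" if "R i k" "R i' k'" "k' < k" for i i' k k'
    using that decr[of i' k' i k] func[of i k k'] by (metis linorder_neqE_linordered_idom order.asym)
  have up: "R (i + 1) (k - 1)" if "R i k" for i k
  proof -
    obtain k' where k': "R (i + 1) k'" using total by blast
    obtain i' where i': "R i' (k - 1)" using total by blast
    have "k' < k" using decr[OF that k'] by simp
    moreover have "i < i'" using decr'[OF that i'] by simp
    \<comment> \<open>If \<open>k' < k - 1\<close>, the partner \<open>i'\<close> of the skipped
      value \<open>k - 1\<close> would lie strictly between \<open>i\<close> and
      \<open>i + 1\<close>.\<close>
    moreover have "\<not> k' < k - 1" using decr'[OF i' k'] \<open>i < i'\<close> by linarith
    ultimately have "k' = k - 1" by simp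
    then show ?thesis using k' by simp
  qed
  have down: "R (i - 1) (k + 1)" if "R i k" for i k
  proof -
    obtain k' where k': "R (i - 1) k'" using total by blast
    obtain i' where i': "R i' (k + 1)" using total by blast
    have "k < k'" using decr[OF k' that] by simp
    moreover have "i' < i" using decr'[OF i' that] by simp
    moreover have "\<not> k + 1 < k'" using decr'[OF k' i'] \<open>i' < i\<close> by linarith
    ultimately have "k' = k + 1" by simp
    then show ?thesis using k' by simp
  qed
  show ?thesis
  proof (induction n rule: int_induct[where k = 0])
    case base
    then show ?case using assms(5) by simp
  next
    case (step1 n)
    then show ?case using up[of "i + n" "k - n"] by (simp add: algebra_simps)
  next
    case (step2 n)
    then show ?case using down[of "i + n" "k - n"] by (simp add: algebra_simps)
  qed
qed

text \<open>With one index fixed, \<open>V\<close> relates the other two by a decreasing bijection,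
  which can only be a shift against a shift. Starting from \<open>(0, 0, 0)\<close>, shifts with
  fixed \<open>j\<close> and then with fixed \<open>i\<close> reach the whole plane.\<close>

lemma incidence_diagonal:
  assumes w: "\<And>n. width a n \<ge> 1" "\<And>n. width b n \<ge> 1" "\<And>n. width c n \<ge> 1"
    and V: "incidence a b c V"
  shows "V = {(i, j, k). i + j + k = 0}"
proof -
  have gap: "f i + 1 \<le> f i'" if "\<And>n. width f n \<ge> 1" "i < i'" for f and i i' :: int
  proof -
    have "real_of_int (i' - i) \<ge> 1" using that(2) by linarith
    then show ?thesis using width_sum_ge[OF that(1), of i i'] that(2) by simp
  qed
  have V0: "(0, 0, 0) \<in> V"
    and ex: "\<And>j k. \<exists>!i. (i, j, k) \<in> V" "\<And>k i. \<exists>!j. (i, j, k) \<in> V" "\<And>i j. \<exists>!k. (i, j, k) \<in> V"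
    and half: "\<And>i j k. (i, j, k) \<in> V \<Longrightarrow> \<bar>a i + b j + c k\<bar> = 1 / 2"
    using V unfolding incidence_def by simp_all
  have ex': "\<exists>i. (i, j, k) \<in> V" "\<exists>j. (i, j, k) \<in> V" "\<exists>k. (i, j, k) \<in> V" for i j k
    using ex(1)[of j k] ex(2)[of i k] ex(3)[of i j] by blast+
  have uniq: "(i, j, k) \<in> V \<Longrightarrow> (i', j, k) \<in> V \<Longrightarrow> i = i'" "(i, j, k) \<in> V \<Longrightarrow> (i, j', k) \<in> V \<Longrightarrow> j = j'"
    "(i, j, k) \<in> V \<Longrightarrow> (i, j, k') \<in> V \<Longrightarrow> k = k'" for i j k i' j' k'
    using ex(1)[of j k] ex(2)[of i k] ex(3)[of i j] by blast+
  \<comment> \<open>Two numbers of modulus 1/2 differ by at most 1, while raising both indices would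
    raise the sum by at least 2. Here \<open>f\<close> stands for \<open>a\<close> or
    \<open>b\<close>, and \<open>x\<close> for the coordinate held fixed.\<close>
  have decr: "k' < k"
    if "f i + 1 \<le> f i'" "\<bar>f i + x + c k\<bar> = 1 / 2" "\<bar>f i' + x + c k'\<bar> = 1 / 2" "k \<noteq> k'"
    for f :: "int \<Rightarrow> real" and x i i' k k'
  proof (rule ccontr)
    assume "\<not> k' < k"
    then have "c k + 1 \<le> c k'" using gap[of c k k'] w that(4) by simp
    then show False using that by linarith
  qed
  have shift1: "(i + n, j, k - n) \<in> V" if "(i, j, k) \<in> V" for i j k n
  proof (rule decreasing_relation_shift[where R = "\<lambda>i k. (i, j, k) \<in> V"])
    fix i i' k k' assume *: "(i, j, k) \<in> V" "(i', j, k') \<in> V" "i < i'"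
    then have "k \<noteq> k'" using uniq(1) by blast
    then show "k' < k"
      using decr[of a i i' "b j" k k'] gap[of a i i'] w(1) half * by blast
  qed (fact ex' uniq that)+
  have shift2: "(i, j + n, k - n) \<in> V" if "(i, j, k) \<in> V" for i j k n
  proof (rule decreasing_relation_shift[where R = "\<lambda>j k. (i, j, k) \<in> V"])
    fix j j' k k' assume *: "(i, j, k) \<in> V" "(i, j', k') \<in> V" "j < j'"
    then have "k \<noteq> k'" using uniq(2) by blast
    then show "k' < k"
      using decr[of b j j' "a i" k k'] gap[of b j j'] w(2) half[OF *(1)] half[OF *(2)] *(3)
      by (simp add: add.commute)
  qed (fact ex' uniq that)+
  have mem: "(i, j, - i - j) \<in> V" for i j
    using shift2[OF shift1[OF V0, of i], of j] by simp
  have "(i, j, k) \<in> V \<longleftrightarrow> i + j + k = 0" for i j k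
  proof -
    have "(i, j, k) \<in> V \<longleftrightarrow> k = - i - j" using mem[of i j] uniq(3) by blast
    then show ?thesis by linarith
  qed
  then show ?thesis by auto
qed

text \<open>Eliminates the existentially quantified index set; the later arguments on coordinates
  use only this form.\<close>

lemma sturmian_lattice_iff:
  "sturmian_lattice a b c \<longleftrightarrow>
     (\<forall>n. width a n \<ge> 1 \<and> width b n \<ge> 1 \<and> width c n \<ge> 1) \<and>
     (\<forall>i j k. i + j + k = 0 \<longrightarrow> \<bar>a i + b j + c k\<bar> = 1 / 2)"
  (is "?L \<longleftrightarrow> ?w \<and> ?h")
proof
  assume ?L
  then obtain V where w: ?w and V: "incidence a b c V"
    unfolding sturmian_lattice_def by blast
  have "V = {(i, j, k). i + j + k = 0}"
    using incidence_diagonal[OF _ _ _ V] w by blast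
  then show "?w \<and> ?h" using w V unfolding incidence_def by blast
next
  assume R: "?w \<and> ?h"
  have "\<exists>!i. i + j + k = 0" "\<exists>!j. i + j + k = 0" "\<exists>!k. i + j + k = 0" for i j k :: int
    by (rule ex1I[of _ "- j - k"] ex1I[of _ "- i - k"] ex1I[of _ "- i - j"]; simp; fail)+
  then have "incidence a b c {(i, j, k). i + j + k = 0}"
    using R unfolding incidence_def by simp
  then show ?L using R unfolding sturmian_lattice_def by blast
qed

lemma sturmian_incidence_iff:
  assumes "sturmian_lattice a b c"
  shows "incidence a b c V \<longleftrightarrow> V = {(i, j, k). i + j + k = 0}"
proof -
  obtain V' where "incidence a b c V'" and "\<forall>n. width a n \<ge> 1 \<and> width b n \<ge> 1 \<and> width c n \<ge> 1"
    using assms unfolding sturmian_lattice_def by blast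
  then show ?thesis using incidence_diagonal by metis
qed

section \<open>Working rules and symmetries of Sturmian lattices\<close>

lemma sturmian_half:
  assumes "sturmian_lattice a b c" "i + j + k = 0"
  shows "\<bar>a i + b j + c k\<bar> = 1 / 2"
  using assms unfolding sturmian_lattice_iff by blast

lemma sturmian_width:
  assumes "sturmian_lattice a b c"
  shows "width a n \<ge> 1" "width b n \<ge> 1" "width c n \<ge> 1"
  using assms unfolding sturmian_lattice_iff by blast+

lemma sturmian_latticeI:
  assumes "\<And>n. width a n \<ge> 1" "\<And>n. width b n \<ge> 1" "\<And>n. width c n \<ge> 1"
    and "\<And>i j k. i + j + k = 0 \<Longrightarrow> \<bar>a i + b j + c k\<bar> = 1 / 2"
  shows "sturmian_lattice a b c"
  using assms unfolding sturmian_lattice_iff by blast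

lemma sturmian_rotate:
  assumes "sturmian_lattice a b c"
  shows "sturmian_lattice c a b"
proof (rule sturmian_latticeI)
  show "\<bar>c i + a j + b k\<bar> = 1 / 2" if "i + j + k = 0" for i j k
    using sturmian_half[OF assms, of j k i] that by (simp add: algebra_simps)
qed (use sturmian_width[OF assms] in simp_all)

lemma sturmian_reflect:
  assumes "sturmian_lattice a b c"
  shows "sturmian_lattice (\<lambda>n. - a (- n)) (\<lambda>n. - b (- n)) (\<lambda>n. - c (- n))"
proof (rule sturmian_latticeI)
  show "width (\<lambda>n. - a (- n)) n \<ge> 1" "width (\<lambda>n. - b (- n)) n \<ge> 1"
    "width (\<lambda>n. - c (- n)) n \<ge> 1" for n
    using sturmian_width[OF assms, of "- n - 1"] by (simp_all add: width_def)
  show "\<bar>- a (- i) + - b (- j) + - c (- k)\<bar> = 1 / 2" if "i + j + k = 0" for i j k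
  proof -
    have "- a (- i) + - b (- j) + - c (- k) = - (a (- i) + b (- j) + c (- k))" by simp
    moreover have "- i + - j + - k = 0" using that by simp
    ultimately show ?thesis by (simp only: abs_minus_cancel sturmian_half[OF assms])
  qed
qed

text \<open>The shifts \<open>p\<close>, \<open>q\<close>, \<open>r\<close> renumber the lines and
  preserve the plane \<open>i + j + k = 0\<close>; the offsets \<open>s\<close>, \<open>t\<close>,
  \<open>u\<close> come from a translation of the plane. Both triples therefore sum to zero.\<close>

lemma sturmian_translate:
  assumes "sturmian_lattice a b c" "p + q + r = 0" "s + t + u = 0"
  shows "sturmian_lattice (\<lambda>n. a (n + p) + s) (\<lambda>n. b (n + q) + t) (\<lambda>n. c (n + r) + u)"
proof (rule sturmian_latticeI)
  show "width (\<lambda>n. a (n + p) + s) n \<ge> 1" "width (\<lambda>n. b (n + q) + t) n \<ge> 1"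
    "width (\<lambda>n. c (n + r) + u) n \<ge> 1" for n
    using sturmian_width(1)[OF assms(1), of "n + p"] sturmian_width(2)[OF assms(1), of "n + q"]
      sturmian_width(3)[OF assms(1), of "n + r"] by (simp_all add: width_def ac_simps)
  show "\<bar>a (i + p) + s + (b (j + q) + t) + (c (k + r) + u)\<bar> = 1 / 2" if "i + j + k = 0" for i j k
  proof -
    have "a (i + p) + s + (b (j + q) + t) + (c (k + r) + u) = a (i + p) + b (j + q) + c (k + r)"
      using assms(3) by linarith
    moreover have "i + p + (j + q) + (k + r) = 0" using that assms(2) by simp
    ultimately show ?thesis by (simp only: sturmian_half[OF assms(1)])
  qed
qed

section \<open>Isometries\<close>

lemma isometric_latticesI:
  assumes "sturmian_lattice a b c" "sturmian_lattice a' b' c'"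
    and "\<And>p q. dist (T p) (T q) = dist p q"
    and "(\<lambda>t. (\<lambda>l. T ` l) ` t) ` line_triples a b c {(i, j, k). i + j + k = 0}
         = line_triples a' b' c' {(i, j, k). i + j + k = 0}"
  shows "isometric_lattices a b c a' b' c'"
proof -
  let ?V = "{(i, j, k). i + j + k = (0 :: int)}"
  have "incidence a b c ?V" "incidence a' b' c' ?V"
    using sturmian_incidence_iff assms(1,2) by simp_all
  then show ?thesis
    unfolding isometric_lattices_def using assms(3,4) by (intro exI[of _ T] exI[of _ ?V]) simp
qed

text \<open>Each of the two given isometries brings its own index set for the middle lattice. Since
  that lattice is Sturmian, its index set is unique, so the two agree and the maps can be
  composed.\<close>

lemma isometric_lattices_trans:
  assumes "sturmian_lattice a' b' c'"
    and "isometric_lattices a b c a' b' c'" "isometric_lattices a' b' c' a'' b'' c''"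
  shows "isometric_lattices a b c a'' b'' c''"
proof -
  obtain T V V' where T: "\<And>p q. dist (T p) (T q) = dist p q" and V: "incidence a b c V" "incidence a' b' c' V'"
    and TV: "(\<lambda>t. (\<lambda>l. T ` l) ` t) ` line_triples a b c V = line_triples a' b' c' V'"
    using assms(2) unfolding isometric_lattices_def by (elim exE conjE) (rule that; simp)
  obtain S W V'' where S: "\<And>p q. dist (S p) (S q) = dist p q" and W: "incidence a' b' c' W" "incidence a'' b'' c'' V''"
    and SW: "(\<lambda>t. (\<lambda>l. S ` l) ` t) ` line_triples a' b' c' W = line_triples a'' b'' c'' V''"
    using assms(3) unfolding isometric_lattices_def by (elim exE conjE) (rule that; simp)
  have "W = V'" using V W sturmian_incidence_iff[OF assms(1)] by simp
  have comp_eq: "(\<lambda>t. (\<lambda>l. (S \<circ> T) ` l) ` t) ` X = (\<lambda>t. (\<lambda>l. S ` l) ` t) ` ((\<lambda>t. (\<lambda>l. T ` l) ` t) ` X)" for X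
    by (simp only: comp_def image_image)
  have "(\<lambda>t. (\<lambda>l. (S \<circ> T) ` l) ` t) ` line_triples a b c V = line_triples a'' b'' c'' V''"
    using SW by (simp only: comp_eq TV \<open>W = V'\<close>)
  moreover have "dist ((S \<circ> T) p) ((S \<circ> T) q) = dist p q" for p q using S T by simp
  ultimately show ?thesis
    using V(1) W(2) unfolding isometric_lattices_def
    by (intro exI[of _ "S \<circ> T"] exI[of _ V] exI[of _ V'']) simp
qed

section \<open>Action of plane isometries on lines and lattices\<close>

lemma image_lineI:
  assumes "\<And>p. T (S p) = p" and "\<And>p. T p \<in> line \<theta>' x' \<longleftrightarrow> p \<in> line \<theta> x"
  shows "T ` line \<theta> x = line \<theta>' x'"
proof (intro subset_antisym subsetI)
  fix y assume "y \<in> line \<theta>' x'"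
  then have "S y \<in> line \<theta> x" using assms(1)[of y] assms(2)[of "S y"] by simp
  then show "y \<in> T ` line \<theta> x" using assms(1)[of y] by (metis imageI)
qed (use assms(2) in blast)

lemma rotate_line: "(\<lambda>p. cis \<phi> * p) ` line \<theta> x = line (\<theta> + \<phi>) x"
proof (rule image_lineI[where S = "\<lambda>p. cis (- \<phi>) * p"])
  fix p
  show "cis \<phi> * (cis (- \<phi>) * p) = p" by (simp add: cis_mult flip: mult.assoc)
  \<comment> \<open>The factor equals 1. Left expanded, it turns the claim into a polynomial
    identity in the coordinates of \<open>p\<close> and the sines and cosines of both
    angles.\<close>
  have "inner (cis \<phi> * p) (\<i> * cis (\<theta> + \<phi>))
      = inner p (\<i> * cis \<theta>) * ((cos \<phi>)\<^sup>2 + (sin \<phi>)\<^sup>2)"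
    by (simp add: inner_complex_def cos_add sin_add power2_eq_square algebra_simps
             del: sin_cos_squared_add sin_cos_squared_add2 sin_cos_squared_add3)
  then show "cis \<phi> * p \<in> line (\<theta> + \<phi>) x \<longleftrightarrow> p \<in> line \<theta> x"
    by (simp add: line_def)
qed

lemma translate_line: "(\<lambda>p. p + v) ` line \<theta> x = line \<theta> (x + inner v (\<i> * cis \<theta>))"
  by (rule image_lineI[where S = "\<lambda>p. p - v"]) (auto simp: line_def inner_add_left)

lemma reflect_line: "uminus ` line \<theta> x = line \<theta> (- x)"
  by (rule image_lineI[where S = uminus]) (auto simp: line_def)

lemma isometric_rotate:
  assumes "sturmian_lattice a b c"
  shows "isometric_lattices a b c c a b"
proof (rule isometric_latticesI[OF assms sturmian_rotate[OF assms], where T = "\<lambda>p. cis (2 * pi / 3) * p"])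
  show "dist (cis (2 * pi / 3) * p) (cis (2 * pi / 3) * q) = dist p q" for p q
    by (simp add: dist_norm norm_mult flip: right_diff_distrib)
  \<comment> \<open>The rotation takes the third family to angle \<open>2 * pi\<close>, that is,
    back to angle 0; hence the three families are permuted cyclically.\<close>
  have period: "line (2 * pi) x = line 0 x" for x by (simp add: line_def)
  have img: "(\<lambda>l. (*) (cis (2 * pi / 3)) ` l) ` {line 0 x, line (2 * pi / 3) y, line (4 * pi / 3) z}
      = {line 0 z, line (2 * pi / 3) x, line (4 * pi / 3) y}" for x y z
    by (simp add: rotate_line period insert_commute)
  show "(\<lambda>t. (\<lambda>l. (*) (cis (2 * pi / 3)) ` l) ` t) ` line_triples a b c {(i, j, k). i + j + k = 0}
      = line_triples c a b {(i, j, k). i + j + k = 0}" (is "?L = ?R")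
  proof (intro subset_antisym subsetI)
    fix t assume "t \<in> ?L"
    then obtain i j k where "i + j + k = 0" and t: "t = {line 0 (c k), line (2 * pi / 3) (a i), line (4 * pi / 3) (b j)}"
      unfolding line_triples_def by (auto simp only: img mem_Collect_eq prod.case)
    then have "k + i + j = 0" by simp
    then show "t \<in> ?R" unfolding line_triples_def t by blast
  next
    fix t assume "t \<in> ?R"
    then obtain i j k where "k + i + j = 0" and t: "t = {line 0 (c k), line (2 * pi / 3) (a i), line (4 * pi / 3) (b j)}"
      unfolding line_triples_def by auto
    moreover from this have "i + j + k = 0" by simp
    moreover have "t = (\<lambda>l. (*) (cis (2 * pi / 3)) ` l) ` {line 0 (a i), line (2 * pi / 3) (b j), line (4 * pi / 3) (c k)}"
      by (simp only: img t)
    ultimately show "t \<in> ?L" unfolding line_triples_def by blast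
  qed
qed

text \<open>The point reflection negates all coordinates; numbering the lines by \<open>- n\<close>
  makes them increasing again.\<close>

lemma isometric_reflect:
  assumes "sturmian_lattice a b c"
  shows "isometric_lattices a b c (\<lambda>n. - a (- n)) (\<lambda>n. - b (- n)) (\<lambda>n. - c (- n))"
proof (rule isometric_latticesI[OF assms sturmian_reflect[OF assms], where T = uminus])
  show "dist (- p) (- q) = dist p q" for p q :: complex
    by (simp add: dist_minus)
  have img: "(\<lambda>l. uminus ` l) ` {line 0 x, line (2 * pi / 3) y, line (4 * pi / 3) z}
      = {line 0 (- x), line (2 * pi / 3) (- y), line (4 * pi / 3) (- z)}" for x y z
    by (simp add: reflect_line)
  show "(\<lambda>t. (\<lambda>l. uminus ` l) ` t) ` line_triples a b c {(i, j, k). i + j + k = 0}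
      = line_triples (\<lambda>n. - a (- n)) (\<lambda>n. - b (- n)) (\<lambda>n. - c (- n)) {(i, j, k). i + j + k = 0}"
    (is "?L = ?R")
  proof (intro subset_antisym subsetI)
    fix t assume "t \<in> ?L"
    then obtain i j k where "i + j + k = 0"
      and t: "t = {line 0 (- a i), line (2 * pi / 3) (- b j), line (4 * pi / 3) (- c k)}"
      unfolding line_triples_def by (auto simp only: img mem_Collect_eq prod.case)
    then have "- i + - j + - k = 0"
      and "t = {line 0 (- a (- (- i))), line (2 * pi / 3) (- b (- (- j))), line (4 * pi / 3) (- c (- (- k)))}" by simp_all
    then show "t \<in> ?R" unfolding line_triples_def by blast
  next
    fix t assume "t \<in> ?R"
    then obtain i j k where "i + j + k = 0"
      and t: "t = {line 0 (- a (- i)), line (2 * pi / 3) (- b (- j)), line (4 * pi / 3) (- c (- k))}"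
      unfolding line_triples_def by auto
    then have "- i + - j + - k = 0" by simp
    moreover have "t = (\<lambda>l. uminus ` l) ` {line 0 (a (- i)), line (2 * pi / 3) (b (- j)), line (4 * pi / 3) (c (- k))}"
      by (simp only: img t)
    ultimately show "t \<in> ?L" unfolding line_triples_def by blast
  qed
qed

lemma isometric_translate:
  assumes "sturmian_lattice a b c" "p + q + r = 0" "s + t + u = 0"
  shows "isometric_lattices a b c (\<lambda>n. a (n + p) + s) (\<lambda>n. b (n + q) + t) (\<lambda>n. c (n + r) + u)"
proof -
  \<comment> \<open>The imaginary part solves the equation for the first normal, the real part then
    the one for the second. The third holds because the normals and \<open>s\<close>,
    \<open>t\<close>, \<open>u\<close> both sum to zero.\<close>
  define v where "v = Complex (- (2 * t + s) / sqrt 3) s"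
  have sin_240: "sin (4 * pi / 3) = - sqrt 3 / 2" and cos_240: "cos (4 * pi / 3) = - 1 / 2"
  proof -
    have e: "4 * pi / 3 = pi / 3 + pi" by simp
    have "sin (pi / 3 + pi) = - sqrt 3 / 2" "cos (pi / 3 + pi) = - 1 / 2"
      using sin_60 cos_60 sin_periodic_pi[of "pi / 3"] cos_periodic_pi[of "pi / 3"] by simp_all
    then show "sin (4 * pi / 3) = - sqrt 3 / 2" "cos (4 * pi / 3) = - 1 / 2"
      by (simp_all only: e)
  qed
  have v: "inner v (\<i> * cis 0) = s" "inner v (\<i> * cis (2 * pi / 3)) = t" "inner v (\<i> * cis (4 * pi / 3)) = u"
    using assms(3) by (simp_all add: v_def inner_complex_def sin_120 cos_120 sin_240 cos_240)  (simp_all add: field_simps)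
  have img: "(\<lambda>l. (\<lambda>p. p + v) ` l) ` {line 0 x, line (2 * pi / 3) y, line (4 * pi / 3) z}
      = {line 0 (x + s), line (2 * pi / 3) (y + t), line (4 * pi / 3) (z + u)}" for x y z
    by (simp only: image_insert image_empty translate_line v)
  show ?thesis
  proof (rule isometric_latticesI[OF assms(1) sturmian_translate[OF assms], where T = "\<lambda>p. p + v"])
    show "dist (p + v) (q + v) = dist p q" for p q by simp
    show "(\<lambda>t. (\<lambda>l. (\<lambda>p. p + v) ` l) ` t) ` line_triples a b c {(i, j, k). i + j + k = 0}
      = line_triples (\<lambda>n. a (n + p) + s) (\<lambda>n. b (n + q) + t) (\<lambda>n. c (n + r) + u) {(i, j, k). i + j + k = 0}"
      (is "?L = ?R")
    proof (intro subset_antisym subsetI)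
      fix x assume "x \<in> ?L"
      then obtain i j k where "i + j + k = 0"
        and x: "x = {line 0 (a i + s), line (2 * pi / 3) (b j + t), line (4 * pi / 3) (c k + u)}"
        unfolding line_triples_def by (auto simp only: img mem_Collect_eq prod.case)
      then have "(i - p) + (j - q) + (k - r) = 0" using assms(2) by simp
      moreover have "x = {line 0 (a (i - p + p) + s), line (2 * pi / 3) (b (j - q + q) + t),
          line (4 * pi / 3) (c (k - r + r) + u)}" using x by simp
      ultimately show "x \<in> ?R" unfolding line_triples_def by blast
    next
      fix x assume "x \<in> ?R"
      then obtain i j k where "i + j + k = 0"
        and x: "x = {line 0 (a (i + p) + s), line (2 * pi / 3) (b (j + q) + t), line (4 * pi / 3) (c (k + r) + u)}"
        unfolding line_triples_def by auto
      then have "(i + p) + (j + q) + (k + r) = 0" using assms(2) by simp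
      moreover have "x = (\<lambda>l. (\<lambda>p. p + v) ` l) ` {line 0 (a (i + p)), line (2 * pi / 3) (b (j + q)), line (4 * pi / 3) (c (k + r))}"
        by (simp only: img x)
      ultimately show "x \<in> ?L" unfolding line_triples_def by blast
    qed
  qed
qed

section \<open>Normal forms\<close>

definition normal_form :: "real \<Rightarrow> (int \<Rightarrow> real) \<Rightarrow> (int \<Rightarrow> real) \<Rightarrow> (int \<Rightarrow> real) \<Rightarrow> bool" where
  "normal_form \<kappa> a' b' c' \<longleftrightarrow>
       ((\<exists>\<epsilon> :: int \<Rightarrow> real. (\<forall>i. \<epsilon> i \<in> {- 1 / 2, 1 / 2}) \<and>
           (\<forall>i. a' i = of_int i * \<kappa> + \<epsilon> i) \<and>
           (\<forall>j. b' j = of_int j * \<kappa> - 1 / 2) \<and>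
           (\<forall>k. c' k = of_int k * \<kappa> + 1 / 2))
        \<or>
        ((\<forall>i. a' i = (if i > 0 then of_int i * \<kappa> - 1 / 2 else of_int i * \<kappa> + 1 / 2)) \<and>
         (\<forall>j. b' j = (if j \<ge> 0 then of_int j * \<kappa> - 1 / 2 else of_int j * \<kappa> + 1 / 2)) \<and>
         (\<forall>k. c' k = (if k \<ge> 0 then of_int k * \<kappa> - 1 / 2 else of_int k * \<kappa> + 1 / 2)))
        \<or>
        ((\<forall>i. a' i = (if i > 0 then of_int i * \<kappa> + 1 / 2 else of_int i * \<kappa> - 1 / 2)) \<and>
         (\<forall>j. b' j = (if j \<ge> 0 then of_int j * \<kappa> + 1 / 2 else of_int j * \<kappa> - 1 / 2)) \<and>
         (\<forall>k. c' k = (if k \<ge> 0 then of_int k * \<kappa> + 1 / 2 else of_int k * \<kappa> - 1 / 2))))"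

text \<open>The conclusion of the theorem for a fixed \<open>\<kappa>\<close>. The first part
  concerns the original directions and numbering, up to a translation of the plane; the second
  concerns an isometric copy, in which directions may be permuted or reversed and lines
  renumbered.\<close>

definition has_normal_form :: "real \<Rightarrow> (int \<Rightarrow> real) \<Rightarrow> (int \<Rightarrow> real) \<Rightarrow> (int \<Rightarrow> real) \<Rightarrow> bool" where
  "has_normal_form \<kappa> a b c \<longleftrightarrow>
    (\<exists>s t u :: real. s + t + u = 0 \<and>
       half_perturbed \<kappa> (\<lambda>i. a i - s) \<and>
       half_perturbed \<kappa> (\<lambda>j. b j - t) \<and>
       half_perturbed \<kappa> (\<lambda>k. c k - u)) \<and>
    (\<exists>a' b' c' :: int \<Rightarrow> real.
       sturmian_lattice a' b' c' \<and> isometric_lattices a b c a' b' c' \<and> normal_form \<kappa> a' b' c')"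

lemma has_normal_formI:
  assumes "s + t + u = 0"
    and "half_perturbed \<kappa> (\<lambda>i. a i - s)" "half_perturbed \<kappa> (\<lambda>j. b j - t)" "half_perturbed \<kappa> (\<lambda>k. c k - u)"
    and "sturmian_lattice a' b' c'" "isometric_lattices a b c a' b' c'" "normal_form \<kappa> a' b' c'"
  shows "has_normal_form \<kappa> a b c"
  unfolding has_normal_form_def
  by (intro conjI exI[of _ s] exI[of _ t] exI[of _ u] exI[of _ a'] exI[of _ b'] exI[of _ c'] assms)

lemma has_normal_formE:
  assumes "has_normal_form \<kappa> a b c"
  obtains s t u a' b' c' where "s + t + u = 0"
    "half_perturbed \<kappa> (\<lambda>i. a i - s)" "half_perturbed \<kappa> (\<lambda>j. b j - t)" "half_perturbed \<kappa> (\<lambda>k. c k - u)"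
    "sturmian_lattice a' b' c'" "isometric_lattices a b c a' b' c'" "normal_form \<kappa> a' b' c'"
  using assms unfolding has_normal_form_def by (elim exE conjE) (rule that)

lemma half_perturbedI:
  assumes "\<And>n. f n - of_int n * \<kappa> \<in> {- 1 / 2, 1 / 2}"
  shows "half_perturbed \<kappa> f"
  unfolding half_perturbed_def
  by (rule exI[where x = "\<lambda>n. f n - of_int n * \<kappa>"]) (use assms in auto)

lemma half_perturbedD:
  assumes "half_perturbed \<kappa> f"
  shows "f n - of_int n * \<kappa> \<in> {- 1 / 2, 1 / 2}"
proof -
  obtain \<epsilon> :: "int \<Rightarrow> real" where "\<epsilon> n \<in> {- 1 / 2, 1 / 2}" "f n = of_int n * \<kappa> + \<epsilon> n"
    using assms unfolding half_perturbed_def by blast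
  then show ?thesis by auto
qed

text \<open>Lets a distinguished direction be moved into first place.\<close>

lemma has_normal_form_rotate:
  assumes "sturmian_lattice a b c" "has_normal_form \<kappa> c a b"
  shows "has_normal_form \<kappa> a b c"
  using assms(2)
proof (rule has_normal_formE)
  fix s t u a' b' c'
  assume *: "s + t + u = 0" "half_perturbed \<kappa> (\<lambda>i. c i - s)" "half_perturbed \<kappa> (\<lambda>j. a j - t)"
    "half_perturbed \<kappa> (\<lambda>k. b k - u)" "sturmian_lattice a' b' c'" "isometric_lattices c a b a' b' c'"
    "normal_form \<kappa> a' b' c'"
  show ?thesis
  proof (rule has_normal_formI[OF _ *(3,4,2,5) _ *(7)])
    show "t + u + s = 0" using *(1) by simp
    show "isometric_lattices a b c a' b' c'"
      using isometric_lattices_trans[OF sturmian_rotate isometric_rotate *(6)] assms(1) by simp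
  qed
qed

lemma has_normal_form_rotate2:
  assumes "sturmian_lattice a b c" "has_normal_form \<kappa> b c a"
  shows "has_normal_form \<kappa> a b c"
  using assms has_normal_form_rotate sturmian_rotate by metis

lemma has_normal_form_reflect:
  assumes "sturmian_lattice a b c"
    and "has_normal_form \<kappa> (\<lambda>n. - a (- n)) (\<lambda>n. - b (- n)) (\<lambda>n. - c (- n))"
  shows "has_normal_form \<kappa> a b c"
  using assms(2)
proof (rule has_normal_formE)
  have hp: "half_perturbed \<kappa> (\<lambda>n. f n - - s)" if "half_perturbed \<kappa> (\<lambda>n. - f (- n) - s)" for f s
  proof (rule half_perturbedI)
    fix n show "f n - - s - of_int n * \<kappa> \<in> {- 1 / 2, 1 / 2}"
      using half_perturbedD[OF that, of "- n"] by auto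
  qed
  fix s t u a' b' c'
  assume *: "s + t + u = 0" "half_perturbed \<kappa> (\<lambda>i. - a (- i) - s)" "half_perturbed \<kappa> (\<lambda>j. - b (- j) - t)"
    "half_perturbed \<kappa> (\<lambda>k. - c (- k) - u)" "sturmian_lattice a' b' c'"
    "isometric_lattices (\<lambda>n. - a (- n)) (\<lambda>n. - b (- n)) (\<lambda>n. - c (- n)) a' b' c'"
    "normal_form \<kappa> a' b' c'"
  show ?thesis
  proof (rule has_normal_formI[OF _ *(2-4)[THEN hp] *(5) _ *(7)])
    show "- s + - t + - u = 0" using *(1) by simp
    show "isometric_lattices a b c a' b' c'"
      by (rule isometric_lattices_trans[OF sturmian_reflect isometric_reflect *(6)]) (rule assms(1))+
  qed
qed

section \<open>Reduction of concrete coordinates to the normal forms\<close>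

text \<open>Once \<open>b\<close> and \<open>c\<close> are arithmetic progressions, the half
  condition at \<open>(i, 0, - i)\<close> leaves just two possible values for each
  \<open>a i\<close>. This is case (i).\<close>

lemma has_normal_form_two_arithmetic:
  assumes S: "sturmian_lattice a b c"
    and b: "\<And>n. b n = of_int n * \<kappa> + \<beta>" and c: "\<And>n. c n = of_int n * \<kappa> + \<gamma>"
  shows "has_normal_form \<kappa> a b c"
proof -
  \<comment> \<open>Subtracting \<open>t\<close> and \<open>u\<close> moves the constants of
    \<open>b\<close> and \<open>c\<close> to -1/2 and 1/2; \<open>s\<close> is then forced by the
    zero sum.\<close>
  define s t u where "s = - (\<beta> + \<gamma>)" and "t = \<beta> + 1 / 2" and "u = \<gamma> - 1 / 2"
  have stu: "s + t + u = 0" by (simp add: s_def t_def u_def)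
  have \<epsilon>: "a i - s - of_int i * \<kappa> \<in> {- 1 / 2, 1 / 2}" for i
  proof -
    have "\<bar>a i - s - of_int i * \<kappa>\<bar> = 1 / 2"
      using sturmian_half[OF S, of i 0 "- i"] b[of 0] c[of "- i"] by (simp add: s_def algebra_simps)
    then have "a i - s - of_int i * \<kappa> = - 1 / 2 \<or> a i - s - of_int i * \<kappa> = 1 / 2" by linarith
    then show ?thesis by blast
  qed
  have "half_perturbed \<kappa> (\<lambda>i. a i - s)" "half_perturbed \<kappa> (\<lambda>i. b i - t)" "half_perturbed \<kappa> (\<lambda>i. c i - u)"
    by (rule half_perturbedI, rule \<epsilon>) (rule half_perturbedI, simp add: b c t_def u_def)+
  moreover have "sturmian_lattice (\<lambda>n. a (n + 0) + - s) (\<lambda>n. b (n + 0) + - t) (\<lambda>n. c (n + 0) + - u)"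
    "isometric_lattices a b c (\<lambda>n. a (n + 0) + - s) (\<lambda>n. b (n + 0) + - t) (\<lambda>n. c (n + 0) + - u)"
    using stu by (intro sturmian_translate isometric_translate S; simp)+
  moreover have "normal_form \<kappa> (\<lambda>n. a (n + 0) + - s) (\<lambda>n. b (n + 0) + - t) (\<lambda>n. c (n + 0) + - u)"
    unfolding normal_form_def
    by (intro disjI1 exI[where x = "\<lambda>i. a i - s - of_int i * \<kappa>"])
       (intro conjI allI \<epsilon>; simp add: b c t_def u_def)
  ultimately show ?thesis by (rule has_normal_formI[OF stu])
qed

lemma sum_of_int_mult:
  fixes i j k m :: int and x :: "'a :: ring_1"
  assumes "i + j + k = m"
  shows "of_int i * x + of_int j * x + of_int k * x = of_int m * x"
  unfolding assms[symmetric] by (simp add: distrib_right)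

lemma has_normal_form_three_steps_aux:
  assumes S: "sturmian_lattice a b c" and \<sigma>: "\<sigma> = 1 \<or> \<sigma> = - 1"
    and a: "\<And>n. a n = of_int n * \<kappa> + (\<alpha> + \<sigma> * of_bool (n \<ge> p))"
    and b: "\<And>n. b n = of_int n * \<kappa> + (\<beta> + \<sigma> * of_bool (n \<ge> q))"
    and c: "\<And>n. c n = of_int n * \<kappa> + (\<gamma> + \<sigma> * of_bool (n \<ge> r))"
    and sum: "\<alpha> + \<beta> + \<gamma> = - 3 / 2 * \<sigma>" and pqr: "p + q + r = 1"
  shows "has_normal_form \<kappa> a b c"
proof -
  \<comment> \<open>Renumbering by \<open>p - 1\<close>, \<open>q\<close>, \<open>r\<close>, whose
    sum is 0, moves the steps to 1, 0, 0; this is why the normal form has \<open>i > 0\<close>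
    beside \<open>j \<ge> 0\<close> and \<open>k \<ge> 0\<close>. The offsets make the values around
    each step symmetric about \<open>n * \<kappa>\<close>.\<close>
  define s t u where "s = - ((of_int p - 1) * \<kappa> + \<alpha> + \<sigma> / 2)" and "t = - (of_int q * \<kappa> + \<beta> + \<sigma> / 2)"
    and "u = - (of_int r * \<kappa> + \<gamma> + \<sigma> / 2)"
  have "of_int p * \<kappa> + of_int q * \<kappa> + of_int r * \<kappa> = \<kappa>" using sum_of_int_mult[OF pqr, of \<kappa>] by simp
  then have stu: "s + t + u = 0"
    using sum unfolding s_def t_def u_def left_diff_distrib by linarith
  have hp: "half_perturbed \<kappa> (\<lambda>n. f n - (x + \<sigma> / 2))"
    if "\<And>n. f n = of_int n * \<kappa> + (x + \<sigma> * of_bool (n \<ge> y))" for f x and y :: int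
    using \<sigma> by (intro half_perturbedI) (auto simp: that)
  \<comment> \<open>The half-perturbed part keeps the original numbering, so its offsets carry no
    multiples of \<open>\<kappa>\<close>.\<close>
  have stu': "(\<alpha> + \<sigma> / 2) + (\<beta> + \<sigma> / 2) + (\<gamma> + \<sigma> / 2) = 0" using sum by simp
  have "half_perturbed \<kappa> (\<lambda>n. a n - (\<alpha> + \<sigma> / 2))" "half_perturbed \<kappa> (\<lambda>n. b n - (\<beta> + \<sigma> / 2))"
    "half_perturbed \<kappa> (\<lambda>n. c n - (\<gamma> + \<sigma> / 2))" by (rule hp, rule a b c)+
  moreover have "sturmian_lattice (\<lambda>n. a (n + (p - 1)) + s) (\<lambda>n. b (n + q) + t) (\<lambda>n. c (n + r) + u)"
    "isometric_lattices a b c (\<lambda>n. a (n + (p - 1)) + s) (\<lambda>n. b (n + q) + t) (\<lambda>n. c (n + r) + u)"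
    using stu pqr by (intro sturmian_translate isometric_translate S; simp)+
  moreover have "normal_form \<kappa> (\<lambda>n. a (n + (p - 1)) + s) (\<lambda>n. b (n + q) + t) (\<lambda>n. c (n + r) + u)"
  proof (cases "\<sigma> = 1")
    case True
    then show ?thesis unfolding normal_form_def
      by (intro disjI2) (simp add: a b c s_def t_def u_def algebra_simps)
  next
    case False
    then have "\<sigma> = - 1" using \<sigma> by simp
    then show ?thesis unfolding normal_form_def
      by (intro disjI2 disjI1) (simp add: a b c s_def t_def u_def algebra_simps)
  qed
  ultimately show ?thesis by (rule has_normal_formI[OF stu'])
qed

text \<open>The sum at a point of the plane is a constant \<open>x\<close> plus
  \<open>\<sigma>\<close> times the number of steps already passed. The counts 1 and 2 always occur,
  which fixes \<open>x\<close>; the counts 0 and 3 are then impossible, which bounds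
  \<open>p + q + r\<close> from above and below.\<close>

lemma has_normal_form_three_steps:
  assumes S: "sturmian_lattice a b c" and \<sigma>: "\<sigma> = 1 \<or> \<sigma> = - 1"
    and a: "\<And>n. a n = of_int n * \<kappa> + (\<alpha> + \<sigma> * of_bool (n \<ge> p))"
    and b: "\<And>n. b n = of_int n * \<kappa> + (\<beta> + \<sigma> * of_bool (n \<ge> q))"
    and c: "\<And>n. c n = of_int n * \<kappa> + (\<gamma> + \<sigma> * of_bool (n \<ge> r))"
  shows "has_normal_form \<kappa> a b c"
proof -
  define x where "x = \<alpha> + \<beta> + \<gamma>"
  have val: "\<bar>x + \<sigma> * (of_bool (i \<ge> p) + of_bool (j \<ge> q) + of_bool (k \<ge> r))\<bar> = 1 / 2"
    if "i + j + k = 0" for i j k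
  proof -
    have "of_int i * \<kappa> + of_int j * \<kappa> + of_int k * \<kappa> = 0" using sum_of_int_mult[OF that, of \<kappa>] by simp
    then have "a i + b j + c k = x + \<sigma> * (of_bool (i \<ge> p) + of_bool (j \<ge> q) + of_bool (k \<ge> r))"
      unfolding a b c x_def distrib_left by linarith
    then show ?thesis using sturmian_half[OF S that] by (simp only:)
  qed
  \<comment> \<open>At this point the first two indices are before their steps, and the minimum
    makes \<open>j\<close> small enough for the third index to be at least \<open>r\<close>.\<close>
  have one: "\<bar>x + \<sigma>\<bar> = 1 / 2"
    using val[of "p - 1" "min (q - 1) (1 - p - r)" "- (p - 1) - min (q - 1) (1 - p - r)"]
    by (simp add: min_def split: if_splits)
  \<comment> \<open>Here the first two steps are passed, and the maximum makes \<open>j\<close>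
    large enough for the third index to stay below \<open>r\<close>.\<close>
  have two: "\<bar>x + \<sigma> * 2\<bar> = 1 / 2"
    using val[of p "max q (1 - p - r)" "- p - max q (1 - p - r)"]
    by (simp add: max_def split: if_splits)
  have sum: "x = - 3 / 2 * \<sigma>" using one two \<sigma> by (elim disjE; linarith)
  have "p + q + r < 3"
  proof (rule ccontr)
    assume "\<not> p + q + r < 3"
    then have "\<bar>x\<bar> = 1 / 2" using val[of "p - 1" "q - 1" "2 - p - q"] by simp
    then show False using sum \<sigma> by auto
  qed
  moreover have "p + q + r > 0"
  proof (rule ccontr)
    assume "\<not> p + q + r > 0"
    then have "\<bar>x + \<sigma> * 3\<bar> = 1 / 2" using val[of p q "- p - q"] by simp
    then show False using sum \<sigma> by auto
  qed
  ultimately consider "p + q + r = 1" | "p + q + r = 2" by linarith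
  then show ?thesis
  proof cases
    case 1
    then show ?thesis using has_normal_form_three_steps_aux[OF S \<sigma> a b c] sum x_def by simp
  next
    case 2
    \<comment> \<open>The point reflection keeps \<open>\<sigma>\<close> and sends a step at
      \<open>p\<close> to one at \<open>1 - p\<close>, so the sum of the positions changes from 2 to
      3 - 2 = 1.\<close>
    have "- f (- n) = of_int n * \<kappa> + ((- \<alpha> - \<sigma>) + \<sigma> * of_bool (n \<ge> 1 - p))"
      if "\<And>n. f n = of_int n * \<kappa> + (\<alpha> + \<sigma> * of_bool (n \<ge> p))" for f n \<alpha> and p :: int
      by (auto simp: that of_bool_def)
    note refl = this[OF a] this[OF b] this[OF c]
    show ?thesis
      by (rule has_normal_form_reflect[OF S],
          rule has_normal_form_three_steps_aux[OF sturmian_reflect[OF S] \<sigma> refl])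
         (use sum 2 in \<open>simp_all add: x_def\<close>)
  qed
qed

section \<open>Differences between widths\<close>

text \<open>Raising \<open>i\<close> or raising \<open>j\<close> leads from the same situation to
  two triples with a common third line, and the widths differ by the difference of two sums equal to
  1/2 or -1/2.\<close>

lemma width_diff:
  assumes "sturmian_lattice a b c"
  shows "width a i - width b j \<in> {- 1, 0, 1}"
proof -
  define x where "x = a (i + 1) + b j + c (- i - j - 1)"
  define y where "y = a i + b (j + 1) + c (- i - j - 1)"
  have "\<bar>x\<bar> = 1 / 2" "\<bar>y\<bar> = 1 / 2"
    unfolding x_def y_def by (rule sturmian_half[OF assms], simp)+
  moreover have "width a i - width b j = x - y" by (simp add: x_def y_def width_def)
  ultimately show ?thesis by (auto simp: abs_if split: if_splits)
qed

lemma has_normal_form_gap_two_aux: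
  assumes S: "sturmian_lattice a b c" and w: "width a x = m" "width a y = m + 2"
  shows "has_normal_form (m + 1) a b c"
proof -
  have "width b j = m + 1" for j
    using width_diff[OF S, of x j] width_diff[OF S, of y j] w by auto
  moreover have "width c j = m + 1" for j
    using width_diff[OF sturmian_rotate[OF S], of j x] width_diff[OF sturmian_rotate[OF S], of j y] w by auto
  ultimately show ?thesis
    by (intro has_normal_form_two_arithmetic[OF S, of _ "b 0" "c 0"] width_const)
qed

section \<open>Balancedness and the slope\<close>

lemma range_width_diff:
  assumes "sturmian_lattice a b c"
  shows "v \<in> range (width a) \<Longrightarrow> w \<in> range (width b) \<Longrightarrow> v - w \<in> {- 1, 0, 1}"
    and "v \<in> range (width b) \<Longrightarrow> w \<in> range (width c) \<Longrightarrow> v - w \<in> {- 1, 0, 1}"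
    and "v \<in> range (width c) \<Longrightarrow> w \<in> range (width a) \<Longrightarrow> v - w \<in> {- 1, 0, 1}"
  using width_diff[OF assms] width_diff[OF sturmian_rotate[OF assms]]
    width_diff[OF sturmian_rotate[OF sturmian_rotate[OF assms]]]
  by (elim rangeE; simp only:)+

text \<open>Two widths involve at most two directions. Each is compared with a width of a remaining
  direction, from which it differs by -1, 0 or 1.\<close>

lemma widths_diff:
  assumes "sturmian_lattice a b c" "v \<in> widths a b c" "w \<in> widths a b c"
  shows "w - v \<in> {- 2, - 1, 0, 1, 2}"
proof -
  note d = range_width_diff[OF assms(1)]
  have diff: "w - v \<in> {- 2, - 1, 0, 1, 2}"
    if "v - z \<in> {- 1, 0, 1} \<or> z - v \<in> {- 1, 0, 1}" "w - z \<in> {- 1, 0, 1} \<or> z - w \<in> {- 1, 0, 1}"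
    for z :: real
    using that by auto
  consider "v \<in> range (width a) \<union> range (width b)" "w \<in> range (width a) \<union> range (width b)"
    | "v \<in> range (width b) \<union> range (width c)" "w \<in> range (width b) \<union> range (width c)"
    | "v \<in> range (width a) \<union> range (width c)" "w \<in> range (width a) \<union> range (width c)"
    using assms(2,3) unfolding widths_def by blast
  then show ?thesis
  proof cases
    case 1
    have "x - width c 0 \<in> {- 1, 0, 1} \<or> width c 0 - x \<in> {- 1, 0, 1}"
      if "x \<in> range (width a) \<union> range (width b)" for x
      using that d(2)[of x "width c 0"] d(3)[of "width c 0" x] by (metis UnE rangeI)
    then show ?thesis using 1 diff[of "width c 0"] by simp
  next
    case 2
    have "x - width a 0 \<in> {- 1, 0, 1} \<or> width a 0 - x \<in> {- 1, 0, 1}"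
      if "x \<in> range (width b) \<union> range (width c)" for x
      using that d(3)[of x "width a 0"] d(1)[of "width a 0" x] by (metis UnE rangeI)
    then show ?thesis using 2 diff[of "width a 0"] by simp
  next
    case 3
    have "x - width b 0 \<in> {- 1, 0, 1} \<or> width b 0 - x \<in> {- 1, 0, 1}"
      if "x \<in> range (width a) \<union> range (width c)" for x
      using that d(1)[of x "width b 0"] d(2)[of "width b 0" x] by (metis UnE rangeI)
    then show ?thesis using 3 diff[of "width b 0"] by simp
  qed
qed

text \<open>Widths of different directions differ by at most 1, so both widths lie in one direction,
  which a rotation puts first.\<close>

lemma has_normal_form_gap_two:
  assumes S: "sturmian_lattice a b c" and "m \<in> widths a b c" "m + 2 \<in> widths a b c"
  shows "has_normal_form (m + 1) a b c"
proof -
  note S' = sturmian_rotate[OF S]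
  note S'' = sturmian_rotate[OF S']
  note d = range_width_diff[OF S]
  have "m - (m + 2) \<notin> {- 1, 0, 1}" "m + 2 - m \<notin> {- 1, 0, 1}" by auto
  then consider "m \<in> range (width a)" "m + 2 \<in> range (width a)"
    | "m \<in> range (width b)" "m + 2 \<in> range (width b)"
    | "m \<in> range (width c)" "m + 2 \<in> range (width c)"
    using assms(2,3) d[of m "m + 2"] d[of "m + 2" m] unfolding widths_def by (metis UnE)
  then show ?thesis
  proof cases
    case 1
    then obtain x y where "m = width a x" "m + 2 = width a y" by blast
    then show ?thesis using has_normal_form_gap_two_aux[OF S] by metis
  next
    case 2
    then obtain x y where "m = width b x" "m + 2 = width b y" by blast
    then show ?thesis using has_normal_form_gap_two_aux[OF S''] has_normal_form_rotate2[OF S] by metis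
  next
    case 3
    then obtain x y where "m = width c x" "m + 2 = width c y" by blast
    then show ?thesis using has_normal_form_gap_two_aux[OF S'] has_normal_form_rotate[OF S] by metis
  qed
qed

section \<open>Slope as mean width, and balanced sequences\<close>

lemma sum_width: "(\<Sum>i\<in>{- int N..<int N}. width f i) = f (int N) - f (- int N)"
proof (induction N)
  case (Suc N)
  have "{- int (Suc N)..<int (Suc N)} = insert (- 1 - int N) (insert (int N) {- int N..<int N})" by auto
  then show ?case using Suc.IH by (simp add: width_def ac_simps)
qed simp

text \<open>Each width is \<open>m\<close> plus the indicator of being long, so telescoping turns
  the density of long widths into the mean growth of \<open>a\<close>.\<close>

lemma has_slope_imp_mean_width:
  assumes w: "\<And>i. width a i \<in> {m, m + 1}" and m: "m = Min (widths a b c)" and "has_slope a b c s"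
  shows "(\<lambda>N. (a (int N) - a (- int N)) / (2 * real N)) \<longlonglongrightarrow> m + s"
proof -
  have count: "a (int N) - a (- int N) = 2 * real N * m + real (card {i \<in> {- int N..<int N}. width a i = m + 1})"
    for N
  proof -
    have "width a i = m + of_bool (width a i = m + 1)" for i using w[of i] by auto
    then have "a (int N) - a (- int N) = (\<Sum>i\<in>{- int N..<int N}. m + of_bool (width a i = m + 1))"
      using sum_width[of a N] by simp
    also have "\<dots> = 2 * real N * m + real (card {i \<in> {- int N..<int N}. width a i = m + 1})"
      by (simp add: sum.distrib sum_of_bool_eq Int_def)
    finally show ?thesis .
  qed
  have "(\<lambda>N. m + real (card {i \<in> {- int N..<int N}. width a i = m + 1}) / (2 * real N)) \<longlonglongrightarrow> m + s"
    using assms(3) unfolding has_slope_def m[symmetric] by (intro tendsto_intros)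
  \<comment> \<open>At \<open>N = 0\<close> division by zero makes the right side 0, so the two
    sequences are compared only for positive \<open>N\<close>.\<close>
  moreover have "\<forall>\<^sub>F N in sequentially. m + real (card {i \<in> {- int N..<int N}. width a i = m + 1}) / (2 * real N)
      = (a (int N) - a (- int N)) / (2 * real N)"
    using eventually_gt_at_top[of 0] by eventually_elim (simp add: count field_simps)
  ultimately show ?thesis by (rule Lim_transform_eventually)
qed

lemma window_growth:
  fixes F :: "int \<Rightarrow> real"
  assumes "\<And>i. F (i + L) - F i \<ge> \<delta>"
  shows "F (i + int M * L) - F i \<ge> real M * \<delta>"
proof (induction M)
  case (Suc M)
  then show ?case using assms[of "i + int M * L"] by (simp add: algebra_simps)
qed simp

text \<open>The mean is known for \<open>F\<close> alone, and balancedness transfers it. A window of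
  \<open>G\<close> rising by more than 1 would make all windows of \<open>F\<close> of that length
  rise by a fixed positive amount, against mean 0. A window of \<open>F\<close> rising by more than
  1 would likewise make \<open>G\<close> unbounded, against the bound just found.\<close>

lemma balanced_zero_mean:
  fixes F G :: "int \<Rightarrow> real"
  assumes balanced: "\<And>i n L. \<bar>(F (i + L) - F i) - (G (n + L) - G n)\<bar> \<le> 1"
    and mean: "(\<lambda>N. (F (int N) - F (- int N)) / (2 * real N)) \<longlonglongrightarrow> 0"
    and "L \<ge> 0"
  shows "G (n + L) - G n \<le> 1" and "F (n + L) - F n \<le> 1"
proof -
  have G: "G (n + L) - G n \<le> 1" if "L \<ge> 0" for n L
  proof (rule ccontr)
    assume "\<not> G (n + L) - G n \<le> 1"
    define \<delta> where "\<delta> = G (n + L) - G n - 1"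
    have \<delta>: "\<delta> > 0" using \<open>\<not> G (n + L) - G n \<le> 1\<close> by (simp add: \<delta>_def)
    have "L \<noteq> 0" using \<open>\<not> G (n + L) - G n \<le> 1\<close> by auto
    then have L: "L > 0" using that by simp
    have growth: "F (i + L) - F i \<ge> \<delta>" for i
      using balanced[of i L n] by (simp add: \<delta>_def)
    \<comment> \<open>Along multiples of \<open>L\<close> the interval from \<open>-N\<close> to
      \<open>N\<close> is tiled by \<open>2 * M\<close> windows of length \<open>L\<close>.\<close>
    have sub: "strict_mono (\<lambda>M. M * nat L)" using L by (simp add: strict_mono_def)
    have "(\<lambda>M. (F (int (M * nat L)) - F (- int (M * nat L))) / (2 * real (M * nat L))) \<longlonglongrightarrow> 0"
      using LIMSEQ_subseq_LIMSEQ[OF mean sub] by (simp only: comp_def)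
    moreover have "\<delta> / of_int L \<le> (F (int (M * nat L)) - F (- int (M * nat L))) / (2 * real (M * nat L))"
      if "M \<ge> 1" for M
    proof -
      have "real (2 * M) * \<delta> \<le> F (- (int M * L) + int (2 * M) * L) - F (- (int M * L))"
        using window_growth[where F = F, OF growth] .
      also have "- (int M * L) + int (2 * M) * L = int M * L" by simp
      finally show ?thesis using L that by (simp add: field_simps)
    qed
    ultimately have "\<delta> / of_int L \<le> 0" by (intro LIMSEQ_le_const) auto
    then show False using \<delta> L by (simp add: field_simps)
  qed
  show "G (n + L) - G n \<le> 1" using G \<open>L \<ge> 0\<close> .
  show "F (n + L) - F n \<le> 1"
  proof (rule ccontr)
    assume "\<not> F (n + L) - F n \<le> 1"
    define \<delta> where "\<delta> = F (n + L) - F n - 1"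
    have \<delta>: "\<delta> > 0" using \<open>\<not> F (n + L) - F n \<le> 1\<close> by (simp add: \<delta>_def)
    have growth: "G (i + L) - G i \<ge> \<delta>" for i
      using balanced[of n L i] by (simp add: \<delta>_def)
    obtain M where "1 < real M * \<delta>" using reals_Archimedean3[OF \<delta>] by blast
    also have "\<dots> \<le> G (0 + int M * L) - G 0" using window_growth[where F = G, OF growth] .
    also have "\<dots> \<le> 1" using \<open>L \<ge> 0\<close> by (intro G) simp
    finally show False by simp
  qed
qed

lemma single_step:
  assumes w: "\<And>n. width F n \<in> {0, 1}" and le: "\<And>n L. L \<ge> 0 \<Longrightarrow> F (n + L) - F n \<le> 1"
  shows "(\<exists>\<alpha>. \<forall>n. F n = \<alpha>) \<or> (\<exists>\<alpha> p. \<forall>n. F n = \<alpha> + of_bool (n \<ge> p))"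
proof (cases "\<forall>n. width F n = 0")
  case True
  then have "F n = F 0" for n using width_const[of F 0 n] by simp
  then show ?thesis by blast
next
  case False
  \<comment> \<open>Here \<open>p\<close> is the last index before the rise, so the step position is
    \<open>p + 1\<close>. Monotonicity and the bound 1 leave room for no further rise on either
    side.\<close>
  then obtain p where p: "F (p + 1) = F p + 1" using w by (auto simp: width_def algebra_simps)
  have mono: "F i \<le> F j" if "i \<le> j" for i j
  proof -
    have "width F n \<ge> 0" for n using w[of n] by auto
    from width_sum_ge[of 0 F, OF this that] show ?thesis by simp
  qed
  have "F n = F p + of_bool (n \<ge> p + 1)" for n
  proof (cases "n \<ge> p + 1")
    case True
    then show ?thesis using mono[of "p + 1" n] le[of "n - p" p] p by simp
  next
    case False
    then show ?thesis using mono[of n p] le[of "p + 1 - n" n] p by simp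
  qed
  then show ?thesis by blast
qed

text \<open>The arithmetic direction can compensate any choice of \<open>j\<close> and
  \<open>k\<close>. So there are points past both steps and points before both, whose sums differ by
  2, whereas sums of modulus 1/2 differ by at most 1.\<close>

lemma not_exactly_two_steps:
  assumes S: "sturmian_lattice a b c" and \<sigma>: "\<sigma> = 1 \<or> \<sigma> = - 1"
    and a: "\<And>n. a n = of_int n * \<kappa> + \<alpha>"
    and b: "\<And>n. b n = of_int n * \<kappa> + (\<beta> + \<sigma> * of_bool (n \<ge> q))"
    and c: "\<And>n. c n = of_int n * \<kappa> + (\<gamma> + \<sigma> * of_bool (n \<ge> r))"
  shows False
proof -
  have "\<bar>\<alpha> + \<beta> + \<gamma> + 2 * \<sigma>\<bar> = 1 / 2"
    using sturmian_half[OF S, of "- q - r" q r] by (simp add: a b c algebra_simps)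
  moreover have "\<bar>\<alpha> + \<beta> + \<gamma>\<bar> = 1 / 2"
    using sturmian_half[OF S, of "2 - q - r" "q - 1" "r - 1"] by (simp add: a b c algebra_simps)
  ultimately show False using \<sigma> by (elim disjE; linarith)
qed

section \<open>Slope 0 or 1: at most one step in each direction\<close>

text \<open>Treats both extreme slopes at once: every width is \<open>\<kappa>\<close> or
  \<open>\<kappa> + \<sigma>\<close>, and the mean says that the second kind has density 0 in the
  first direction.\<close>

lemma has_normal_form_extreme_slope:
  assumes S: "sturmian_lattice a b c" and \<sigma>: "\<sigma> = 1 \<or> \<sigma> = - 1"
    and w: "\<And>v. v \<in> widths a b c \<Longrightarrow> \<sigma> * (v - \<kappa>) \<in> {0, 1}"
    and mean: "(\<lambda>N. (a (int N) - a (- int N)) / (2 * real N)) \<longlonglongrightarrow> \<kappa>"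
  shows "has_normal_form \<kappa> a b c"
proof -
  note S' = sturmian_rotate[OF S]
  note S'' = sturmian_rotate[OF S']
  \<comment> \<open>The signed deviation from \<open>n * \<kappa>\<close>: for each direction it is
    nondecreasing with increments 0 and 1, whichever sign \<open>\<sigma>\<close> has.\<close>
  define D where "D f n = \<sigma> * (f n - of_int n * \<kappa>)" for f and n :: int
  have width_D: "width (D f) n = \<sigma> * (width f n - \<kappa>)" for f n
    by (simp add: D_def width_def algebra_simps)
  have steps: "width (D f) n \<in> {0, 1}" if "f \<in> {a, b, c}" for f n
    unfolding width_D using that by (intro w) (auto simp: widths_def)
  have sgn: "\<bar>\<sigma> * x\<bar> = \<bar>x\<bar>" for x using \<sigma> by auto
  have shift: "(D f (i + L) - D f i) - (D g (n + L) - D g n) = \<sigma> * ((f (i + L) - f i) - (g (n + L) - g n))"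
    for f g i n L by (simp add: D_def algebra_simps)
  have diff_le: "\<bar>x - y\<bar> \<le> 1" if "\<bar>x + z\<bar> = 1 / 2" "\<bar>y + z\<bar> = 1 / 2" for x y z :: real
    using that by linarith
  have balanced_b: "\<bar>(D a (i + L) - D a i) - (D b (n + L) - D b n)\<bar> \<le> 1" for i n L
  proof -
    \<comment> \<open>The triples \<open>(i + L, n, k)\<close> and \<open>(i, n + L, k)\<close> with
      \<open>k = - i - L - n\<close> both lie in the index plane and share their third line.\<close>
    have "\<bar>(a (i + L) + b n) - (a i + b (n + L))\<bar> \<le> 1"
      by (rule diff_le[where z = "c (- i - L - n)"]) (rule sturmian_half[OF S], simp)+
    then show ?thesis unfolding shift sgn by (simp add: algebra_simps)
  qed
  have balanced_c: "\<bar>(D a (i + L) - D a i) - (D c (n + L) - D c n)\<bar> \<le> 1" for i n L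
  proof -
    have "\<bar>(c n + a (i + L)) - (c (n + L) + a i)\<bar> \<le> 1"
      by (rule diff_le[where z = "b (- i - L - n)"]) (rule sturmian_half[OF S'], simp)+
    then show ?thesis unfolding shift sgn by (simp add: algebra_simps)
  qed
  have "(\<lambda>N. \<sigma> * ((a (int N) - a (- int N)) / (2 * real N) - \<kappa>)) \<longlonglongrightarrow> \<sigma> * (\<kappa> - \<kappa>)"
    by (intro tendsto_intros mean)
  moreover have "\<forall>\<^sub>F N in sequentially. \<sigma> * ((a (int N) - a (- int N)) / (2 * real N) - \<kappa>)
      = (D a (int N) - D a (- int N)) / (2 * real N)"
    using eventually_gt_at_top[of 0] by eventually_elim (simp add: D_def field_simps)
  ultimately have mean_D: "(\<lambda>N. (D a (int N) - D a (- int N)) / (2 * real N)) \<longlonglongrightarrow> 0"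
    using Lim_transform_eventually by fastforce
  define arith where "arith f \<longleftrightarrow> (\<exists>\<alpha>. \<forall>n. f n = of_int n * \<kappa> + \<alpha>)" for f
  define step where "step f \<longleftrightarrow> (\<exists>\<alpha> p. \<forall>n. f n = of_int n * \<kappa> + (\<alpha> + \<sigma> * of_bool (n \<ge> p)))" for f
  have dichotomy: "arith f \<or> step f" if "f \<in> {a, b, c}" for f
  proof -
    have "D f (n + L) - D f n \<le> 1" if "L \<ge> 0" for n L
      using \<open>f \<in> {a, b, c}\<close> balanced_zero_mean[OF balanced_b mean_D that] balanced_zero_mean[OF balanced_c mean_D that]
      by auto
    from single_step[of "D f", OF steps[OF that] this]
    have "(\<exists>\<alpha>. \<forall>n. D f n = \<alpha>) \<or> (\<exists>\<alpha> p. \<forall>n. D f n = \<alpha> + of_bool (n \<ge> p))" .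
    moreover have "f n = of_int n * \<kappa> + \<sigma> * D f n" for n using \<sigma> by (auto simp: D_def)
    ultimately show ?thesis unfolding arith_def step_def by (metis distrib_left)
  qed
  have two: "has_normal_form \<kappa> f g h" if "sturmian_lattice f g h" "arith g" "arith h" for f g h
    using that has_normal_form_two_arithmetic unfolding arith_def by metis
  have no: False if "sturmian_lattice f g h" "arith f" "step g" "step h" for f g h
    using that not_exactly_two_steps[OF _ \<sigma>] unfolding arith_def step_def by metis
  have three: "has_normal_form \<kappa> a b c" if "step a" "step b" "step c"
    using that has_normal_form_three_steps[OF S \<sigma>] unfolding step_def by metis
  \<comment> \<open>By the number of directions with a step: none or one leaves two arithmetic
    directions, two is impossible, and three is the remaining normal form.\<close>
  show ?thesis
    using dichotomy[of a] dichotomy[of b] dichotomy[of c] three two[OF S] two[OF S'] two[OF S'']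
      no[OF S] no[OF S'] no[OF S''] has_normal_form_rotate[OF S] has_normal_form_rotate2[OF S] by auto
qed

lemma sturmian_has_normal_form:
  assumes S: "sturmian_lattice a b c"
    and colors: "strictly_n_color 3 a b c \<or>
         (n_color 2 a b c \<and> (has_slope a b c 0 \<or> has_slope a b c 1))"
  shows "\<exists>\<kappa>. has_normal_form \<kappa> a b c"
proof -
  define m where "m = Min (widths a b c)"
  have fin: "finite (widths a b c)"
    using colors unfolding strictly_n_color_def n_color_def by blast
  have "widths a b c \<noteq> {}" by (auto simp: widths_def)
  then have m: "m \<in> widths a b c" "\<And>v. v \<in> widths a b c \<Longrightarrow> m \<le> v"
    using fin by (simp_all add: m_def)
  show ?thesis
  proof (cases "m + 2 \<in> widths a b c")
    case True
    then show ?thesis using has_normal_form_gap_two[OF S m(1)] by blast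
  next
    case False
    \<comment> \<open>Differences of widths are integers of modulus at most 2; minimality of
      \<open>m\<close> removes the negative ones and the case assumption removes 2.\<close>
    have w: "v \<in> {m, m + 1}" if "v \<in> widths a b c" for v
      using widths_diff[OF S m(1) that] m(2)[OF that] that False
      by (auto simp: algebra_simps)
    have "card (widths a b c) \<le> card {m, m + 1}"
      using w by (intro card_mono) blast+
    also have "\<dots> = 2" by simp
    finally have "\<not> strictly_n_color 3 a b c"
      using fin by (simp add: strictly_n_color_def n_color_def)
    then consider "has_slope a b c 0" | "has_slope a b c 1" using colors by blast
    then show ?thesis
    proof cases
      \<comment> \<open>Slope 0 makes the short width \<open>m\<close> the one of density 1, with
        deviations upwards; for slope 1 it is the long width \<open>m + 1\<close>, with deviations
        downwards.\<close>
      case 1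
      have "has_normal_form m a b c"
      proof (rule has_normal_form_extreme_slope[OF S, of 1])
        show "1 * (v - m) \<in> {0, 1}" if "v \<in> widths a b c" for v using w[OF that] by auto
        show "(\<lambda>N. (a (int N) - a (- int N)) / (2 * real N)) \<longlonglongrightarrow> m"
          using has_slope_imp_mean_width[OF _ m_def 1] w by (simp add: widths_def)
      qed simp
      then show ?thesis ..
    next
      case 2
      have "has_normal_form (m + 1) a b c"
      proof (rule has_normal_form_extreme_slope[OF S, of "- 1"])
        show "- 1 * (v - (m + 1)) \<in> {0, 1}" if "v \<in> widths a b c" for v using w[OF that] by auto
        show "(\<lambda>N. (a (int N) - a (- int N)) / (2 * real N)) \<longlonglongrightarrow> m + 1"
          using has_slope_imp_mean_width[OF _ m_def 2] w by (simp add: widths_def)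
      qed simp
      then show ?thesis ..
    qed
  qed
qed

theorem theorem4p8:
  fixes a b c :: "int \<Rightarrow> real"
  assumes "sturmian_lattice a b c"
    and "strictly_n_color 3 a b c \<or>
         (n_color 2 a b c \<and> (has_slope a b c 0 \<or> has_slope a b c 1))"
  shows "\<exists>\<kappa>::real.
    (\<exists>s t u :: real. s + t + u = 0 \<and>
       half_perturbed \<kappa> (\<lambda>i. a i - s) \<and>
       half_perturbed \<kappa> (\<lambda>j. b j - t) \<and>
       half_perturbed \<kappa> (\<lambda>k. c k - u)) \<and>
    (\<exists>a' b' c' :: int \<Rightarrow> real.
       sturmian_lattice a' b' c' \<and> isometric_lattices a b c a' b' c' \<and>
       ((\<exists>\<epsilon> :: int \<Rightarrow> real. (\<forall>i. \<epsilon> i \<in> {- 1 / 2, 1 / 2}) \<and>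
           (\<forall>i. a' i = of_int i * \<kappa> + \<epsilon> i) \<and>
           (\<forall>j. b' j = of_int j * \<kappa> - 1 / 2) \<and>
           (\<forall>k. c' k = of_int k * \<kappa> + 1 / 2))
        \<or>
        ((\<forall>i. a' i = (if i > 0 then of_int i * \<kappa> - 1 / 2 else of_int i * \<kappa> + 1 / 2)) \<and>
         (\<forall>j. b' j = (if j \<ge> 0 then of_int j * \<kappa> - 1 / 2 else of_int j * \<kappa> + 1 / 2)) \<and>
         (\<forall>k. c' k = (if k \<ge> 0 then of_int k * \<kappa> - 1 / 2 else of_int k * \<kappa> + 1 / 2)))
        \<or>
        ((\<forall>i. a' i = (if i > 0 then of_int i * \<kappa> + 1 / 2 else of_int i * \<kappa> - 1 / 2)) \<and>
         (\<forall>j. b' j = (if j \<ge> 0 then of_int j * \<kappa> + 1 / 2 else of_int j * \<kappa> - 1 / 2)) \<and>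
         (\<forall>k. c' k = (if k \<ge> 0 then of_int k * \<kappa> + 1 / 2 else of_int k * \<kappa> - 1 / 2)))))"
  using sturmian_has_normal_form[OF assms] unfolding has_normal_form_def normal_form_def .

end
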